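(* Let $\mathcal V$ be a variety with lattice-terms and let $A$ be an absolute retract in $\mathcal V$. Then every down directed subset $X\subseteq A$ (with respect to the natural order of $A$) has an infimum $\bigwedge X$ in $A$. Moreover, if $P(x)$ is a positive first-order formula in one free variable of the language of $\mathcal V$ such that every $a\in X$ satisfies $P(x)$ in $A$, then $\bigwedge X$ also satisfies $P(x)$ in $A$.
   Context: A variety $\mathcal V$ has lattice-terms if there are terms of its language defining on each $A\in\mathcal V$ binary operations $\vee,\wedge$ such that $\langle A,\vee,\wedge\rangle$ is a lattice; the corresponding lattice order is the natural order of $A$. A subset $X$ of an ordered set is down directed if it is nonempty and for all $a,b\in X$ there is $x\in X$ with $x\le a$ and $x\le b$. $A\in\mathcal V$ is an absolute retract in $\mathcal V$ if for every $B\in\mathcal V$ and every injective homomorphism $i:A\to B$ there is a homomorphism $r:B\to A$ with $r\circ i=1_A$. A positive formula is a first-order formula built from atomic formulas using only $\wedge$, $\vee$, $\exists$, $\forall$ (no negation or implication). *)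

theory Defs
  imports "HOL-Algebra.Lattice"
begin

section \<open>Algebras over a finitary signature\<close>

text \<open>A language of algebras is a type \<open>'f\<close> of operation symbols with an arity function
  \<open>ar :: 'f \<Rightarrow> nat\<close>. Operations are total functions on lists; only their values on lists of the
  right length over the carrier are meaningful.\<close>

record ('a, 'f) ualg = "'a partial_object" +
  interp :: "'f \<Rightarrow> 'a list \<Rightarrow> 'a"

definition is_ualg :: "('f \<Rightarrow> nat) \<Rightarrow> ('a, 'f) ualg \<Rightarrow> bool" where
  "is_ualg ar A \<longleftrightarrow> carrier A \<noteq> {} \<and>
    (\<forall>f xs. length xs = ar f \<longrightarrow> set xs \<subseteq> carrier A \<longrightarrow> interp A f xs \<in> carrier A)"

definition ualg_hom :: "('f \<Rightarrow> nat) \<Rightarrow> ('a, 'f) ualg \<Rightarrow> ('b, 'f) ualg \<Rightarrow> ('a \<Rightarrow> 'b) set" where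
  "ualg_hom ar A B = {h. h ` carrier A \<subseteq> carrier B \<and>
    (\<forall>f xs. length xs = ar f \<longrightarrow> set xs \<subseteq> carrier A \<longrightarrow>
       h (interp A f xs) = interp B f (map h xs))}"

datatype 'f trm = Var nat | App 'f "'f trm list"

primrec wf_trm :: "('f \<Rightarrow> nat) \<Rightarrow> 'f trm \<Rightarrow> bool" where
  "wf_trm ar (Var n) \<longleftrightarrow> True"
| "wf_trm ar (App f ts) \<longleftrightarrow> length ts = ar f \<and> list_all (\<lambda>b. b) (map (wf_trm ar) ts)"

primrec vars_trm :: "'f trm \<Rightarrow> nat set" where
  "vars_trm (Var n) = {n}"
| "vars_trm (App f ts) = \<Union> (set (map vars_trm ts))"

primrec eval :: "('a, 'f) ualg \<Rightarrow> (nat \<Rightarrow> 'a) \<Rightarrow> 'f trm \<Rightarrow> 'a" where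
  "eval A v (Var n) = v n"
| "eval A v (App f ts) = interp A f (map (eval A v) ts)"


section \<open>Varieties\<close>

text \<open>A variety is given by a set \<open>E\<close> of identities; it is the class of all algebras (on any type)
  in which the identities of \<open>E\<close> hold.\<close>

definition wf_identities :: "('f \<Rightarrow> nat) \<Rightarrow> ('f trm \<times> 'f trm) set \<Rightarrow> bool" where
  "wf_identities ar E \<longleftrightarrow> (\<forall>(s, t) \<in> E. wf_trm ar s \<and> wf_trm ar t)"

definition in_variety ::
  "('f \<Rightarrow> nat) \<Rightarrow> ('f trm \<times> 'f trm) set \<Rightarrow> ('a, 'f) ualg \<Rightarrow> bool" where
  "in_variety ar E A \<longleftrightarrow> is_ualg ar A \<and>
    (\<forall>(s, t) \<in> E. \<forall>v. range v \<subseteq> carrier A \<longrightarrow> eval A v s = eval A v t)"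

text \<open>HOL cannot quantify over types inside a formula, so ``for every \<open>B\<close> in the variety'' is
  relative to a type of possible elements of \<open>B\<close>, passed as an \<open>itself\<close> argument. For an algebra
  with elements in \<open>'a\<close> and operation symbols in \<open>'f\<close> the type \<open>('a, 'f) universe\<close> below is large
  enough for this to lose nothing:

  \<^item> If an identity fails somewhere in the variety, it fails in the free algebra on countably many
    generators, which has at most \<open>|'f| + \<aleph>\<^sub>0\<close> elements.

  \<^item> If \<open>A\<close> is not a retract of some extension \<open>B\<close> in the variety, let \<open>\<theta>\<close> be a congruence of \<open>B\<close>
    that is maximal among those restricting to equality on \<open>A\<close>. Then \<open>B/\<theta>\<close> is a proper essential
    extension of \<open>A\<close>. That two given elements of \<open>A\<close> lie in a given principal congruence is
    witnessed by a finite Maltsev chain, so by a Loewenheim-Skolem argument \<open>B/\<theta>\<close> has a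
    subalgebra that is a proper essential extension of \<open>A\<close> with at most \<open>|'a| + |'f| + \<aleph>\<^sub>0\<close>
    elements; and \<open>A\<close> is not a retract of a proper essential extension.\<close>

type_synonym ('a, 'f) universe = "('a \<Rightarrow> 'a + 'f + nat) set"

definition absolute_retract ::
  "'u itself \<Rightarrow> ('f \<Rightarrow> nat) \<Rightarrow> ('f trm \<times> 'f trm) set \<Rightarrow> ('a, 'f) ualg \<Rightarrow> bool" where
  "absolute_retract (_ :: 'u itself) ar E A \<longleftrightarrow> in_variety ar E A \<and>
    (\<forall>(B :: ('u, 'f) ualg) i. in_variety ar E B \<longrightarrow> i \<in> ualg_hom ar A B \<longrightarrow>
       inj_on i (carrier A) \<longrightarrow>
       (\<exists>r \<in> ualg_hom ar B A. \<forall>a \<in> carrier A. r (i a) = a))"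


section \<open>Lattice-terms and the natural order\<close>

definition lattice_ops :: "'a set \<Rightarrow> ('a \<Rightarrow> 'a \<Rightarrow> 'a) \<Rightarrow> ('a \<Rightarrow> 'a \<Rightarrow> 'a) \<Rightarrow> bool" where
  "lattice_ops S jn mt \<longleftrightarrow>
    (\<forall>x\<in>S. \<forall>y\<in>S. jn x y \<in> S \<and> mt x y \<in> S) \<and>
    (\<forall>x\<in>S. \<forall>y\<in>S. jn x y = jn y x \<and> mt x y = mt y x) \<and>
    (\<forall>x\<in>S. \<forall>y\<in>S. \<forall>z\<in>S. jn (jn x y) z = jn x (jn y z) \<and> mt (mt x y) z = mt x (mt y z)) \<and>
    (\<forall>x\<in>S. \<forall>y\<in>S. jn x (mt x y) = x \<and> mt x (jn x y) = x)"

definition binary_trm :: "('f \<Rightarrow> nat) \<Rightarrow> 'f trm \<Rightarrow> bool" where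
  "binary_trm ar t \<longleftrightarrow> wf_trm ar t \<and> vars_trm t \<subseteq> {0, 1}"

definition binop :: "('a, 'f) ualg \<Rightarrow> 'f trm \<Rightarrow> 'a \<Rightarrow> 'a \<Rightarrow> 'a" where
  "binop A t a b = eval A (\<lambda>n. if n = 0 then a else b) t"

definition lattice_terms ::
  "'u itself \<Rightarrow> ('f \<Rightarrow> nat) \<Rightarrow> ('f trm \<times> 'f trm) set \<Rightarrow> 'f trm \<Rightarrow> 'f trm \<Rightarrow> bool" where
  "lattice_terms (_ :: 'u itself) ar E tj tm \<longleftrightarrow> binary_trm ar tj \<and> binary_trm ar tm \<and>
    (\<forall>B :: ('u, 'f) ualg. in_variety ar E B \<longrightarrow>
       lattice_ops (carrier B) (binop B tj) (binop B tm))"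

definition natural_order :: "('a, 'f) ualg \<Rightarrow> 'f trm \<Rightarrow> 'a gorder" where
  "natural_order A tm =
    \<lparr>carrier = carrier A, eq = (=), le = (\<lambda>x y. binop A tm x y = x)\<rparr>"

definition down_directed :: "'a gorder \<Rightarrow> 'a set \<Rightarrow> bool" where
  "down_directed L X \<longleftrightarrow> X \<noteq> {} \<and> X \<subseteq> carrier L \<and>
    (\<forall>a\<in>X. \<forall>b\<in>X. \<exists>x\<in>X. x \<sqsubseteq>\<^bsub>L\<^esub> a \<and> x \<sqsubseteq>\<^bsub>L\<^esub> b)"


section \<open>First-order formulas\<close>

datatype 'f fm =
    Eq "'f trm" "'f trm"
  | Neg "'f fm"
  | Imp "'f fm" "'f fm"
  | Conj "'f fm" "'f fm"
  | Disj "'f fm" "'f fm"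
  | Ex nat "'f fm"
  | All nat "'f fm"

primrec wf_fm :: "('f \<Rightarrow> nat) \<Rightarrow> 'f fm \<Rightarrow> bool" where
  "wf_fm ar (Eq s t) \<longleftrightarrow> wf_trm ar s \<and> wf_trm ar t"
| "wf_fm ar (Neg p) \<longleftrightarrow> wf_fm ar p"
| "wf_fm ar (Imp p q) \<longleftrightarrow> wf_fm ar p \<and> wf_fm ar q"
| "wf_fm ar (Conj p q) \<longleftrightarrow> wf_fm ar p \<and> wf_fm ar q"
| "wf_fm ar (Disj p q) \<longleftrightarrow> wf_fm ar p \<and> wf_fm ar q"
| "wf_fm ar (Ex n p) \<longleftrightarrow> wf_fm ar p"
| "wf_fm ar (All n p) \<longleftrightarrow> wf_fm ar p"

primrec free_vars :: "'f fm \<Rightarrow> nat set" where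
  "free_vars (Eq s t) = vars_trm s \<union> vars_trm t"
| "free_vars (Neg p) = free_vars p"
| "free_vars (Imp p q) = free_vars p \<union> free_vars q"
| "free_vars (Conj p q) = free_vars p \<union> free_vars q"
| "free_vars (Disj p q) = free_vars p \<union> free_vars q"
| "free_vars (Ex n p) = free_vars p - {n}"
| "free_vars (All n p) = free_vars p - {n}"

primrec positive :: "'f fm \<Rightarrow> bool" where
  "positive (Eq s t) \<longleftrightarrow> True"
| "positive (Neg p) \<longleftrightarrow> False"
| "positive (Imp p q) \<longleftrightarrow> False"
| "positive (Conj p q) \<longleftrightarrow> positive p \<and> positive q"
| "positive (Disj p q) \<longleftrightarrow> positive p \<and> positive q"
| "positive (Ex n p) \<longleftrightarrow> positive p"
| "positive (All n p) \<longleftrightarrow> positive p"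

primrec sat :: "('a, 'f) ualg \<Rightarrow> (nat \<Rightarrow> 'a) \<Rightarrow> 'f fm \<Rightarrow> bool" where
  "sat A v (Eq s t) \<longleftrightarrow> eval A v s = eval A v t"
| "sat A v (Neg p) \<longleftrightarrow> \<not> sat A v p"
| "sat A v (Imp p q) \<longleftrightarrow> (sat A v p \<longrightarrow> sat A v q)"
| "sat A v (Conj p q) \<longleftrightarrow> sat A v p \<and> sat A v q"
| "sat A v (Disj p q) \<longleftrightarrow> sat A v p \<or> sat A v q"
| "sat A v (Ex n p) \<longleftrightarrow> (\<exists>a \<in> carrier A. sat A (v(n := a)) p)"
| "sat A v (All n p) \<longleftrightarrow> (\<forall>a \<in> carrier A. sat A (v(n := a)) p)"

text \<open>For a formula with at most one free variable, its value at \<open>a\<close> is obtained by assigning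
  \<open>a\<close> to every variable.\<close>

definition sat_at :: "('a, 'f) ualg \<Rightarrow> 'f fm \<Rightarrow> 'a \<Rightarrow> bool" where
  "sat_at A P a \<longleftrightarrow> sat A (\<lambda>_. a) P"

end

theory Submission
  imports Defs
begin

text \<open>
  Let \<open>U\<close> be an ultrafilter on \<open>X\<close> containing every set \<open>{x \<in> X. x \<le> a}\<close> with \<open>a \<in> X\<close>, and let \<open>r\<close>
  be a retraction of the ultrapower \<open>A\<^sup>X / U\<close> onto the diagonal copy of \<open>A\<close>. The class of the
  identity of \<open>X\<close> lies below every \<open>a \<in> X\<close> and above every lower bound of \<open>X\<close>, so its image under
  \<open>r\<close> is the infimum of \<open>X\<close>. A formula that holds on \<open>X\<close> holds at this class by Los's theorem, and
  surjective homomorphisms preserve positive formulas.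
\<close>

section \<open>Ultrafilters\<close>

text \<open>Smaller in the order of filters means finer, so an ultrafilter is a minimal filter other
  than \<open>bot\<close>. Zorn's lemma is applied to the reversed order on the proper filters below
  \<open>F\<close>.\<close>

lemma ultrafilter_exists:
  assumes "F \<noteq> (bot :: 'i filter)"
  obtains U where "U \<le> F" "U \<noteq> bot"
    "\<And>P. eventually P U \<or> eventually (\<lambda>x. \<not> P x) U"
proof -
  let ?S = "{G. G \<noteq> bot \<and> G \<le> F}"
  have "\<exists>U\<in>?S. \<forall>G\<in>?S. U \<ge> G \<longrightarrow> G = U"
  proof (rule predicate_Zorn[where P = "\<lambda>x y. x \<ge> y"])
    show "partial_order_on ?S (relation_of (\<lambda>x y. x \<ge> y) ?S)"
      by (auto simp: partial_order_on_def preorder_on_def refl_on_def trans_def antisym_def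
          relation_of_def)
  next
    fix C assume "C \<in> Chains (relation_of (\<lambda>x y. x \<ge> y) ?S)"
    then have C: "C \<subseteq> ?S" "\<And>G H. G \<in> C \<Longrightarrow> H \<in> C \<Longrightarrow> G \<le> H \<or> H \<le> G"
      by (auto simp: Chains_def relation_of_def)
    show "\<exists>L\<in>?S. \<forall>G\<in>C. G \<ge> L"
    proof (cases "C = {}")
      case True
      then show ?thesis using assms by auto
    next
      case False
      \<comment> \<open>A chain is a filter base: a predicate is eventually true in
        \<open>Inf C\<close> only if it already is in some member. Hence \<open>Inf C\<close> cannot
        be \<open>bot\<close> when no member is.\<close>
      have "\<exists>K\<in>C. K \<le> inf G H" if "G \<in> C" "H \<in> C" for G H
        using C(2)[OF that] that by (auto intro: bexI[of _ G] bexI[of _ H])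
      then have "eventually P (Inf C) \<longleftrightarrow> (\<exists>G\<in>C. eventually P G)" for P
        using False by (intro eventually_Inf_base) auto
      then have "Inf C \<noteq> bot"
        using C(1) by (auto simp: trivial_limit_def)
      moreover have "Inf C \<le> F"
        using False C(1) by (auto intro: Inf_lower2)
      ultimately show ?thesis
        by (auto intro: Inf_lower)
    qed
  qed
  then obtain U where U: "U \<noteq> bot" "U \<le> F"
    and min: "\<And>G. G \<noteq> bot \<Longrightarrow> G \<le> F \<Longrightarrow> G \<le> U \<Longrightarrow> G = U"
    by blast
  have "eventually P U \<or> eventually (\<lambda>x. \<not> P x) U" for P
  \<comment> \<open>Restrict \<open>U\<close> to the set where \<open>P\<close> holds. If the
    restriction is improper, the complement is \<open>U\<close>-large; otherwise minimality makes it
    equal to \<open>U\<close>, so \<open>P\<close> holds eventually.\<close>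
  proof (cases "inf U (principal {x. P x}) = bot")
    case True
    then show ?thesis
      by (auto simp: trivial_limit_def eventually_inf_principal)
  next
    case False
    then have "inf U (principal {x. P x}) = U"
      using U(2) by (intro min) (auto intro: le_infI1)
    then show ?thesis
      by (metis (no_types, lifting) always_eventually eventually_inf_principal
          mem_Collect_eq)
  qed
  with U that show thesis by blast
qed


section \<open>Positive formulas and homomorphisms\<close>

lemma eval_in_carrier:
  assumes "is_ualg ar A" "wf_trm ar t" "range v \<subseteq> carrier A"
  shows "eval A v t \<in> carrier A"
  using assms(2)
proof (induction t)
  case (Var n)
  then show ?case using assms(3) by auto
next
  case (App f ts)
  then have "set (map (eval A v) ts) \<subseteq> carrier A"
    by (auto simp: list_all_iff)
  then show ?case
    using App.prems assms(1) by (simp add: is_ualg_def)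
qed

lemma eval_hom:
  assumes "h \<in> ualg_hom ar A B" "is_ualg ar A" "wf_trm ar t" "range v \<subseteq> carrier A"
  shows "h (eval A v t) = eval B (\<lambda>n. h (v n)) t"
  using assms(3)
proof (induction t)
  case (Var n)
  then show ?case by simp
next
  case (App f ts)
  then have wf: "\<forall>t\<in>set ts. wf_trm ar t"
    by (auto simp: list_all_iff)
  then have "set (map (eval A v) ts) \<subseteq> carrier A"
    using eval_in_carrier[OF assms(2) _ assms(4)] by auto
  then have "h (eval A v (App f ts)) = interp B f (map h (map (eval A v) ts))"
    using App.prems assms(1) by (simp add: ualg_hom_def)
  also have "map h (map (eval A v) ts) = map (eval B (\<lambda>n. h (v n))) ts"
    using App.IH wf by simp
  finally show ?case by simp
qed

lemma binop_hom:
  assumes "h \<in> ualg_hom ar A B" "is_ualg ar A" "wf_trm ar t" "a \<in> carrier A" "b \<in> carrier A"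
  shows "h (binop A t a b) = binop B t (h a) (h b)"
  using assms unfolding binop_def by (subst eval_hom) (auto simp: if_distrib)

text \<open>Homomorphisms preserve equations between terms, and each positive connective passes this
  on. Surjectivity serves the universal quantifier.\<close>

lemma positive_sat_surj_hom:
  assumes h: "h \<in> ualg_hom ar A B" "is_ualg ar A" and surj: "h ` carrier A = carrier B"
    and "wf_fm ar P" "positive P" "range v \<subseteq> carrier A" "sat A v P"
  shows "sat B (\<lambda>n. h (v n)) P"
  using assms(4-)
proof (induction P arbitrary: v)
  case (Eq s t)
  have "h (eval A v u) = eval B (\<lambda>n. h (v n)) u" if "wf_trm ar u" for u
    using eval_hom[OF h that] Eq.prems by simp
  from this[of s] this[of t] show ?case
    using Eq.prems by simp
next
  case (Ex n P)
  then obtain a where a: "a \<in> carrier A" "sat A (v(n := a)) P" by auto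
  have "range (v(n := a)) \<subseteq> carrier A"
    using a(1) Ex.prems by auto
  from Ex.IH[OF _ _ this a(2)] have "sat B (\<lambda>m. h ((v(n := a)) m)) P"
    using Ex.prems by simp
  also have "(\<lambda>m. h ((v(n := a)) m)) = (\<lambda>m. h (v m))(n := h a)" by (simp add: fun_eq_iff)
  finally show ?case
    unfolding sat.simps by (rule bexI) (use a(1) surj in auto)
next
  case (All n P)
  have "sat B ((\<lambda>m. h (v m))(n := h a)) P" if a: "a \<in> carrier A" for a
  proof -
    have "range (v(n := a)) \<subseteq> carrier A" "sat A (v(n := a)) P"
      using a All.prems by auto
    from All.IH[OF _ _ this] have "sat B (\<lambda>m. h ((v(n := a)) m)) P"
      using All.prems by simp
    also have "(\<lambda>m. h ((v(n := a)) m)) = (\<lambda>m. h (v m))(n := h a)" by (simp add: fun_eq_iff)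
    finally show ?thesis .
  qed
  \<comment> \<open>Every value of the variable quantified over \<open>B\<close> has the form
    \<open>h a\<close>.\<close>
  then show ?case by (simp flip: surj)
qed auto


section \<open>Reduced powers\<close>

text \<open>The injection \<open>Inl\<close> only serves to make the classes elements of \<open>universe\<close>.\<close>

definition rclass :: "'i filter \<Rightarrow> ('i \<Rightarrow> 'a) \<Rightarrow> ('i \<Rightarrow> 'a + 'c) set" where
  "rclass F h = {k. \<forall>\<^sub>F x in F. k x = Inl (h x)}"

text \<open>The representative is taken with all its values in \<open>S\<close>, not just almost
  all, so that operations of the algebra can be applied to it at each index.\<close>

definition rrep :: "'i filter \<Rightarrow> 'a set \<Rightarrow> ('i \<Rightarrow> 'a + 'c) set \<Rightarrow> 'i \<Rightarrow> 'a" where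
  "rrep F S c = (SOME h. range h \<subseteq> S \<and> rclass F h = c)"

definition reduced_power ::
  "'i filter \<Rightarrow> ('a, 'f) ualg \<Rightarrow> (('i \<Rightarrow> 'a + 'c) set, 'f) ualg" where
  "reduced_power F A = \<lparr>carrier = rclass F ` {h. range h \<subseteq> carrier A},
    interp = (\<lambda>f cs. rclass F (\<lambda>x. interp A f (map (\<lambda>c. rrep F (carrier A) c x) cs)))\<rparr>"

text \<open>A function lies in its own class after composition with \<open>Inl\<close>, so equal
  classes force eventual equality; conversely, eventual equality is transitive.\<close>

lemma rclass_eq_iff:
  fixes F :: "'i filter" and g h :: "'i \<Rightarrow> 'a"
  shows "(rclass F g :: ('i \<Rightarrow> 'a + 'c) set) = rclass F h \<longleftrightarrow> (\<forall>\<^sub>F x in F. g x = h x)"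
    (is "?g = ?h \<longleftrightarrow> _")
proof
  assume "?g = ?h"
  moreover have "(\<lambda>x. Inl (g x)) \<in> ?g"
    by (simp add: rclass_def)
  ultimately have "(\<lambda>x. Inl (g x)) \<in> ?h"
    by simp
  then show "\<forall>\<^sub>F x in F. g x = h x"
    by (simp add: rclass_def)
next
  assume *: "\<forall>\<^sub>F x in F. g x = h x"
  have "(\<forall>\<^sub>F x in F. k x = Inl (g x)) \<longleftrightarrow> (\<forall>\<^sub>F x in F. k x = Inl (h x))" for k :: "'i \<Rightarrow> 'a + 'c"
    using * by (intro eventually_cong) (auto elim: eventually_mono)
  then show "?g = ?h"
    by (simp add: rclass_def)
qed

lemma rrep_rclass:
  fixes F :: "'i filter" and h :: "'i \<Rightarrow> 'a"
  assumes "range h \<subseteq> S"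
  shows "\<forall>\<^sub>F x in F. rrep F S (rclass F h :: ('i \<Rightarrow> 'a + 'c) set) x = h x"
proof -
  let ?c = "rclass F h :: ('i \<Rightarrow> 'a + 'c) set"
  have "rclass F (rrep F S ?c) = ?c"
    unfolding rrep_def by (rule someI2[of _ h]) (use assms in blast)+
  then show ?thesis by (simp only: rclass_eq_iff)
qed

lemma rclass_in_carrier: "range h \<subseteq> carrier A \<Longrightarrow> rclass F h \<in> carrier (reduced_power F A)"
  by (simp add: reduced_power_def)

lemma carrier_reduced_powerE:
  assumes "c \<in> carrier (reduced_power F A)"
  obtains h where "range h \<subseteq> carrier A" "c = rclass F h"
  using assms by (auto simp: reduced_power_def)

text \<open>This is independence of representatives. Each chosen representative agrees with the
  given one on an \<open>F\<close>-large set, and an operation has only finitely many arguments, so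
  all of them agree together on an \<open>F\<close>-large set.\<close>

lemma interp_reduced_power:
  fixes F :: "'i filter" and A :: "('a, 'f) ualg"
  assumes "\<forall>h\<in>set hs. range h \<subseteq> carrier A"
  shows "interp (reduced_power F A :: (('i \<Rightarrow> 'a + 'c) set, 'f) ualg) f (map (rclass F) hs) =
    rclass F (\<lambda>x. interp A f (map (\<lambda>h. h x) hs))"
proof -
  let ?c = "\<lambda>h. rclass F h :: ('i \<Rightarrow> 'a + 'c) set"
  have "\<forall>\<^sub>F x in F. \<forall>h\<in>set hs. rrep F (carrier A) (?c h) x = h x"
    by (rule eventually_ball_finite) (use assms in \<open>simp_all add: rrep_rclass\<close>)
  then have "\<forall>\<^sub>F x in F. interp A f (map (\<lambda>h. rrep F (carrier A) (?c h) x) hs) =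
      interp A f (map (\<lambda>h. h x) hs)"
    by (rule eventually_mono) (auto cong: map_cong)
  then show ?thesis
    by (simp add: reduced_power_def rclass_eq_iff comp_def)
qed

lemma map_rclassE:
  assumes "set cs \<subseteq> carrier (reduced_power F A)"
  obtains hs where "cs = map (rclass F) hs" "\<forall>h\<in>set hs. range h \<subseteq> carrier A"
proof -
  have "\<forall>c\<in>set cs. \<exists>h. range h \<subseteq> carrier A \<and> c = rclass F h"
    using assms by (meson carrier_reduced_powerE subsetD)
  then obtain g where g: "\<forall>c\<in>set cs. range (g c) \<subseteq> carrier A \<and> c = rclass F (g c)"
    by metis
  then have "cs = map (rclass F) (map g cs)"
    by (simp add: map_idI)
  then show thesis
    by (rule that) (use g in auto)
qed

lemma is_ualg_reduced_power:
  assumes "is_ualg ar A"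
  shows "is_ualg ar (reduced_power F A)"
  unfolding is_ualg_def
proof (intro conjI allI impI)
  obtain a where "a \<in> carrier A" using assms by (auto simp: is_ualg_def)
  then show "carrier (reduced_power F A) \<noteq> {}"
    using rclass_in_carrier[of "\<lambda>_. a" A F] by auto
next
  fix f cs
  assume "length cs = ar f" "set cs \<subseteq> carrier (reduced_power F A)"
  then show "interp (reduced_power F A) f cs \<in> carrier (reduced_power F A)"
    using assms
    by (elim map_rclassE)
      (auto simp: interp_reduced_power is_ualg_def image_subset_iff intro!: rclass_in_carrier)
qed

section \<open>Terms and identities in reduced powers\<close>

lemma eval_reduced_power:
  fixes F :: "'i filter" and A :: "('a, 'f) ualg"
  assumes "is_ualg ar A" "wf_trm ar t" "\<And>n. range (h n) \<subseteq> carrier A"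
  shows "eval (reduced_power F A :: (('i \<Rightarrow> 'a + 'c) set, 'f) ualg) (\<lambda>n. rclass F (h n)) t =
    rclass F (\<lambda>x. eval A (\<lambda>n. h n x) t)"
  using assms(2)
proof (induction t)
  case (Var n)
  then show ?case by simp
next
  case (App f ts)
  let ?B = "reduced_power F A :: (('i \<Rightarrow> 'a + 'c) set, 'f) ualg"
  let ?h = "\<lambda>t x. eval A (\<lambda>n. h n x) t"
  have wf: "\<forall>t\<in>set ts. wf_trm ar t"
    using App.prems by (auto simp: list_all_iff)
  have "range (?h t) \<subseteq> carrier A" if "t \<in> set ts" for t
    using wf that assms(3) by (auto intro!: eval_in_carrier[OF assms(1)])
  then have *: "\<forall>h\<in>set (map ?h ts). range h \<subseteq> carrier A"
    by auto
  have "map (eval ?B (\<lambda>n. rclass F (h n))) ts = map (rclass F) (map ?h ts)"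
    using App.IH wf by simp
  moreover have "interp ?B f (map (rclass F) (map ?h ts)) =
      rclass F (\<lambda>x. interp A f (map (\<lambda>h. h x) (map ?h ts)))"
    by (rule interp_reduced_power[OF *])
  ultimately show ?case
    by (simp only: eval.simps map_map comp_def)
qed

lemma valuation_reduced_powerE:
  assumes "range v \<subseteq> carrier (reduced_power F A)"
  obtains h where "v = (\<lambda>n. rclass F (h n))" "\<And>n. range (h n) \<subseteq> carrier A"
proof -
  have "\<forall>n. \<exists>h. range h \<subseteq> carrier A \<and> v n = rclass F h"
    using assms by (meson carrier_reduced_powerE rangeI subsetD)
  then show thesis using that by metis
qed

text \<open>Terms are evaluated indexwise on representatives with all values in \<open>A\<close>, so
  an identity of \<open>A\<close> holds at every index and hence between the classes.\<close>

lemma in_variety_reduced_power: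
  fixes F :: "'i filter" and A :: "('a, 'f) ualg"
  assumes "wf_identities ar E" "in_variety ar E A"
  shows "in_variety ar E (reduced_power F A :: (('i \<Rightarrow> 'a + 'c) set, 'f) ualg)"
    (is "in_variety ar E ?B")
  unfolding in_variety_def
proof
  show "is_ualg ar ?B"
    using assms(2) by (simp add: in_variety_def is_ualg_reduced_power)
next
  show "\<forall>(s, t)\<in>E. \<forall>v. range v \<subseteq> carrier ?B \<longrightarrow> eval ?B v s = eval ?B v t"
  proof clarify
    fix s t and v :: "nat \<Rightarrow> ('i \<Rightarrow> 'a + 'c) set"
    assume st: "(s, t) \<in> E" and v: "range v \<subseteq> carrier ?B"
    obtain h where h: "v = (\<lambda>n. rclass F (h n))" "\<And>n. range (h n) \<subseteq> carrier A"
      using valuation_reduced_powerE[OF v] by metis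
    have "eval A (\<lambda>n. h n x) s = eval A (\<lambda>n. h n x) t" for x
      using assms(2) st h(2) unfolding in_variety_def by fastforce
    then show "eval ?B v s = eval ?B v t"
      using assms st h
        by (auto simp: eval_reduced_power[where ar = ar] in_variety_def wf_identities_def)
  qed
qed

lemma binop_reduced_power:
  assumes "is_ualg ar A" "wf_trm ar t" "range g \<subseteq> carrier A" "range h \<subseteq> carrier A"
  shows "binop (reduced_power F A) t (rclass F g) (rclass F h) =
    rclass F (\<lambda>x. binop A t (g x) (h x))"
proof -
  have "eval (reduced_power F A) (\<lambda>n. rclass F (if n = 0 then g else h)) t =
      rclass F (\<lambda>x. eval A (\<lambda>n. (if n = 0 then g else h) x) t)"
    using assms by (intro eval_reduced_power[where ar = ar]) auto
  then show ?thesis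
    unfolding binop_def by (simp add: if_distrib if_distribR cong: if_cong)
qed

section \<open>The diagonal embedding\<close>

lemma diagonal_hom: "(\<lambda>a. rclass F (\<lambda>_. a)) \<in> ualg_hom ar A (reduced_power F A)"
proof -
  have "rclass F (\<lambda>_. interp A f xs) =
      interp (reduced_power F A) f (map (\<lambda>a. rclass F (\<lambda>_. a)) xs)"
    if "set xs \<subseteq> carrier A" for f xs
    using interp_reduced_power[of "map (\<lambda>a _. a) xs" A F f] that by (auto simp: comp_def)
  then show ?thesis
    by (auto simp: ualg_hom_def intro: rclass_in_carrier)
qed

lemma inj_diagonal: "F \<noteq> bot \<Longrightarrow> inj_on (\<lambda>a. rclass F (\<lambda>_. a)) S"
  by (auto simp: inj_on_def rclass_eq_iff eventually_const)

section \<open>Los's theorem for positive formulas\<close>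

text \<open>Only the direction from the factors to the power is wanted. The ultrafilter property
  enters at disjunctions: if the first disjunct does not hold on a \<open>U\<close>-large set, it
  fails on one, and there the second must hold.\<close>

lemma positive_sat_ultrapower:
  fixes U :: "'i filter" and A :: "('a, 'f) ualg"
  assumes A: "is_ualg ar A"
    and U: "\<And>P. eventually P U \<or> eventually (\<lambda>x. \<not> P x) U"
    and "wf_fm ar P" "positive P" "\<And>n. range (h n) \<subseteq> carrier A"
    and "\<forall>\<^sub>F x in U. sat A (\<lambda>n. h n x) P"
  shows "sat (reduced_power U A :: (('i \<Rightarrow> 'a + 'c) set, 'f) ualg) (\<lambda>n. rclass U (h n)) P"
    (is "sat ?B _ _")
  using assms(3-)
proof (induction P arbitrary: h)
  case (Eq s t)
  then show ?case
    using A by (simp add: eval_reduced_power[where ar = ar] rclass_eq_iff)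
next
  case (Conj P Q)
  then show ?case by (simp add: eventually_conj_iff)
next
  case (Disj P Q)
  consider "\<forall>\<^sub>F x in U. sat A (\<lambda>n. h n x) P" | "\<forall>\<^sub>F x in U. \<not> sat A (\<lambda>n. h n x) P"
    using U by blast
  then show ?case
  proof cases
    case 1
    then show ?thesis using Disj by simp
  next
    case 2
    then have "\<forall>\<^sub>F x in U. sat A (\<lambda>n. h n x) Q"
      using Disj.prems(4) by eventually_elim auto
    then show ?thesis using Disj by simp
  qed
next
  case (Ex n P)
  obtain a0 where a0: "a0 \<in> carrier A" using A by (auto simp: is_ualg_def)
  \<comment> \<open>A witness is chosen at every index that has one; the default \<open>a0\<close>
    at the others keeps \<open>g\<close> inside the carrier everywhere, so that its class is an
    element of the power.\<close>
  define g where "g x = (if \<exists>a\<in>carrier A. sat A ((\<lambda>m. h m x)(n := a)) P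
      then SOME a. a \<in> carrier A \<and> sat A ((\<lambda>m. h m x)(n := a)) P else a0)" for x
  have g: "g x \<in> carrier A \<and> ((\<exists>a\<in>carrier A. sat A ((\<lambda>m. h m x)(n := a)) P) \<longrightarrow>
      sat A ((\<lambda>m. h m x)(n := g x)) P)" for x
    unfolding g_def using a0
    by (auto intro: someI2_ex[where Q = "\<lambda>a. a \<in> carrier A"]
        someI2_ex[where Q = "\<lambda>a. sat A ((\<lambda>m. h m x)(n := a)) P"])
  have "\<forall>\<^sub>F x in U. sat A ((\<lambda>m. h m x)(n := g x)) P"
    using Ex.prems(4) by (rule eventually_mono) (use g in simp)
  also have "(\<lambda>x. (\<lambda>m. h m x)(n := g x)) = (\<lambda>x m. (h(n := g)) m x)" by (simp add: fun_eq_iff)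
  finally have "sat ?B (\<lambda>m. rclass U ((h(n := g)) m)) P"
    using Ex.prems g by (intro Ex.IH) auto
  also have "(\<lambda>m. rclass U ((h(n := g)) m)) = (\<lambda>m. rclass U (h m))(n := rclass U g)" by (simp add: fun_eq_iff)
  finally show ?case
    unfolding sat.simps by (rule bexI) (use g in \<open>auto intro!: rclass_in_carrier\<close>)
next
  case (All n P)
  have "sat ?B ((\<lambda>m. rclass U (h m))(n := rclass U g)) P"
    if g: "range g \<subseteq> carrier A" for g
  proof -
    have "\<forall>\<^sub>F x in U. sat A ((\<lambda>m. h m x)(n := g x)) P"
      using All.prems(4) by (rule eventually_mono) (use g in auto)
    also have "(\<lambda>x. (\<lambda>m. h m x)(n := g x)) = (\<lambda>x m. (h(n := g)) m x)" by (simp add: fun_eq_iff)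
    finally have "sat ?B (\<lambda>m. rclass U ((h(n := g)) m)) P"
      using All.prems g by (intro All.IH) auto
    also have "(\<lambda>m. rclass U ((h(n := g)) m)) = (\<lambda>m. rclass U (h m))(n := rclass U g)" by (simp add: fun_eq_iff)
    finally show ?thesis .
  qed
  then show ?case
    by (auto elim!: carrier_reduced_powerE)
qed auto


section \<open>Infima of down directed sets\<close>

text \<open>The lattice laws are equations: they hold between the images under \<open>h\<close>, and
  injectivity reflects them back to \<open>S\<close>.\<close>

lemma lattice_ops_hom:
  assumes "lattice_ops S' jn' mt'" "inj_on h S" "h ` S \<subseteq> S'"
    and "\<And>x y. x \<in> S \<Longrightarrow> y \<in> S \<Longrightarrow> jn x y \<in> S \<and> mt x y \<in> S"
    and "\<And>x y. x \<in> S \<Longrightarrow> y \<in> S \<Longrightarrow> h (jn x y) = jn' (h x) (h y)"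
    and "\<And>x y. x \<in> S \<Longrightarrow> y \<in> S \<Longrightarrow> h (mt x y) = mt' (h x) (h y)"
  shows "lattice_ops S jn mt"
proof -
  have S': "h x \<in> S'" if "x \<in> S" for x using that assms(3) by auto
  note inj = inj_onD[OF assms(2)] and closed = assms(4)[THEN conjunct1] assms(4)[THEN conjunct2]
  show ?thesis
    unfolding lattice_ops_def
  proof (intro conjI ballI)
    fix x y z assume S: "x \<in> S" "y \<in> S" "z \<in> S"
    note * = S S' closed assms(5,6)
    have "jn' u v = jn' v u" "mt' u v = mt' v u" if "u \<in> S'" "v \<in> S'" for u v
      using assms(1) that by (auto simp: lattice_ops_def)
    note ** = * this
    show "jn x y = jn y x" "mt x y = mt y x"
      by (rule inj; use ** in simp)+
    have "jn' (jn' u v) w = jn' u (jn' v w)" "mt' (mt' u v) w = mt' u (mt' v w)"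
      if "u \<in> S'" "v \<in> S'" "w \<in> S'" for u v w
      using assms(1) that by (auto simp: lattice_ops_def)
    note ** = * this
    show "jn (jn x y) z = jn x (jn y z)" "mt (mt x y) z = mt x (mt y z)"
      by (rule inj; use ** in simp)+
    have "jn' u (mt' u v) = u" "mt' u (jn' u v) = u" if "u \<in> S'" "v \<in> S'" for u v
      using assms(1) that by (auto simp: lattice_ops_def)
    note ** = * this
    show "jn x (mt x y) = x" "mt x (jn x y) = x"
      by (rule inj; use ** in simp)+
  qed (use closed in auto)
qed

text \<open>The hypothesis on lattice terms only speaks about algebras on \<open>universe\<close>, so the lattice laws
  have to be pulled back along a diagonal embedding.\<close>

lemma lattice_ops_variety:
  fixes A :: "('a, 'f) ualg"
  assumes "wf_identities ar E" "lattice_terms TYPE(('a, 'f) universe) ar E tj tm" "in_variety ar E A"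
  shows "lattice_ops (carrier A) (binop A tj) (binop A tm)"
proof (rule lattice_ops_hom)
  \<comment> \<open>For the top filter, eventually means everywhere, so \<open>?B\<close> is a copy
    of the full direct power; indexing by \<open>'a\<close> puts it on the type
    \<open>universe\<close>.\<close>
  let ?F = "Orderings.top :: 'a filter"
  let ?B = "reduced_power ?F A :: (('a, 'f) universe, 'f) ualg"
  have A: "is_ualg ar A" using assms(3) by (simp add: in_variety_def)
  have wf: "wf_trm ar tj" "wf_trm ar tm"
    using assms(2) by (auto simp: lattice_terms_def binary_trm_def)
  show "lattice_ops (carrier ?B) (binop ?B tj) (binop ?B tm)"
    using assms(2) in_variety_reduced_power[OF assms(1,3)] unfolding lattice_terms_def by blast
  show "inj_on (\<lambda>a. rclass ?F (\<lambda>_. a)) (carrier A)"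
    by (rule inj_diagonal) (simp add: trivial_limit_def)
  show "(\<lambda>a. rclass ?F (\<lambda>_. a)) ` carrier A \<subseteq> carrier ?B"
    by (auto intro: rclass_in_carrier)
  show "binop A tj x y \<in> carrier A \<and> binop A tm x y \<in> carrier A"
    if "x \<in> carrier A" "y \<in> carrier A" for x y
    using that wf unfolding binop_def by (auto intro!: eval_in_carrier[OF A])
  show "rclass ?F (\<lambda>_. binop A tj x y) = binop ?B tj (rclass ?F (\<lambda>_. x)) (rclass ?F (\<lambda>_. y))"
    "rclass ?F (\<lambda>_. binop A tm x y) = binop ?B tm (rclass ?F (\<lambda>_. x)) (rclass ?F (\<lambda>_. y))"
    if "x \<in> carrier A" "y \<in> carrier A" for x y
    using binop_hom[OF diagonal_hom A _ that] wf by auto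
qed

text \<open>Each of two greatest lower bounds lies below the other, and commutativity of the meet
  gives antisymmetry.\<close>

lemma glb_natural_order_unique:
  assumes "lattice_ops (carrier A) jn (binop A tm)"
    and "is_glb (natural_order A tm) p X" "is_glb (natural_order A tm) q X"
  shows "p = q"
proof -
  have "p \<in> carrier A" "q \<in> carrier A" "binop A tm p q = p" "binop A tm q p = q"
    using assms(2,3) by (auto simp: greatest_def natural_order_def Lower_def)
  then show ?thesis
    using assms(1) unfolding lattice_ops_def by metis
qed

lemma glb_down_directed:
  fixes A :: "('a, 'f) ualg"
  assumes wfE: "wf_identities ar E"
    and lt: "lattice_terms TYPE(('a, 'f) universe) ar E tj tm"
    and ar: "absolute_retract TYPE(('a, 'f) universe) ar E A"
    and dd: "down_directed (natural_order A tm) X"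
  obtains p where "is_glb (natural_order A tm) p X"
    "\<And>P. wf_fm ar P \<Longrightarrow> positive P \<Longrightarrow> \<forall>a\<in>X. sat_at A P a \<Longrightarrow> sat_at A P p"
proof -
  have AV: "in_variety ar E A" using ar by (simp add: absolute_retract_def)
  then have A: "is_ualg ar A" by (simp add: in_variety_def)
  have wf: "wf_trm ar tm" using lt by (simp add: lattice_terms_def binary_trm_def)
  let ?m = "binop A tm"
  note lat = lattice_ops_variety[OF wfE lt AV]
  have trans: "?m x z = x"
    if "?m x y = x" "?m y z = y" "x \<in> carrier A" "y \<in> carrier A" "z \<in> carrier A" for x y z
    using lat that unfolding lattice_ops_def by metis
  have XA: "X \<subseteq> carrier A" and X0: "X \<noteq> {}"
    and dir: "\<And>a b. a \<in> X \<Longrightarrow> b \<in> X \<Longrightarrow> \<exists>x\<in>X. ?m x a = x \<and> ?m x b = x"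
    using dd by (auto simp: down_directed_def natural_order_def)
  \<comment> \<open>The filters live on the whole type \<open>'a\<close> rather than on
    \<open>X\<close>, so that the ultrapower has elements in \<open>universe\<close>;
    \<open>evX\<close> records that \<open>U\<close> concentrates on \<open>X\<close>.\<close>
  define D where "D a = {x\<in>X. ?m x a = x}" for a
  define F where "F = (INF a\<in>X. principal (D a))"
  have F: "eventually P F \<longleftrightarrow> (\<exists>a\<in>X. \<forall>x\<in>D a. P x)" for P
  proof -
    \<comment> \<open>Directedness of \<open>X\<close> makes the sets \<open>D a\<close> a filter
      base: by transitivity everything below a common lower bound \<open>x\<close> is below both
      \<open>a\<close> and \<open>b\<close>.\<close>
    have "\<exists>x\<in>X. D x \<subseteq> D a \<inter> D b" if ab: "a \<in> X" "b \<in> X" for a b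
    proof -
      obtain x where x: "x \<in> X" "?m x a = x" "?m x b = x" using dir[OF ab] by blast
      have "D x \<subseteq> D a \<inter> D b"
        using x ab XA trans unfolding D_def by (auto intro: trans[where y = x])
      then show ?thesis using x(1) by blast
    qed
    then have "eventually P F \<longleftrightarrow> (\<exists>a\<in>X. eventually P (principal (D a)))"
      unfolding F_def using X0 by (intro eventually_INF_base) auto
    then show ?thesis by (simp add: eventually_principal)
  qed
  have "D a \<noteq> {}" if "a \<in> X" for a
    using dir[OF that that] by (auto simp: D_def)
  then have "F \<noteq> bot"
    using F[of "\<lambda>_. False"] by (auto simp: trivial_limit_def)
  then obtain U where UF: "U \<le> F" and U: "U \<noteq> bot"
    "\<And>P. eventually P U \<or> eventually (\<lambda>x. \<not> P x) U"
    by (rule ultrafilter_exists) blast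
  have evD: "\<forall>\<^sub>F x in U. x \<in> D a" if "a \<in> X" for a
    using that F by (intro filter_leD[OF UF]) auto
  have evX: "\<forall>\<^sub>F x in U. x \<in> X"
  proof -
    obtain a where "a \<in> X" using X0 by blast
    from evD[OF this] show ?thesis by (rule eventually_mono) (simp add: D_def)
  qed

  let ?B = "reduced_power U A :: (('a, 'f) universe, 'f) ualg"
  let ?d = "\<lambda>a. rclass U (\<lambda>_. a)"
  have B: "in_variety ar E ?B" "is_ualg ar ?B"
    using in_variety_reduced_power[OF wfE AV] is_ualg_reduced_power[OF A] by auto
  \<comment> \<open>Since \<open>U\<close> is proper, the diagonal is injective, and the ultrapower
    lies in the variety, so the absolute retract property supplies a retraction.\<close>
  have "\<exists>r \<in> ualg_hom ar ?B A. \<forall>a \<in> carrier A. r (?d a) = a"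
    using ar B(1) diagonal_hom inj_diagonal[OF U(1)] unfolding absolute_retract_def by blast
  then obtain r where r: "r \<in> ualg_hom ar ?B A" "\<And>a. a \<in> carrier A \<Longrightarrow> r (?d a) = a"
    by blast
  obtain a0 where a0: "a0 \<in> X" using X0 by blast
  \<comment> \<open>This is the identity of \<open>X\<close> extended by a default. Taking
    \<open>a0\<close> in \<open>X\<close> keeps all values of \<open>e\<close> in \<open>X\<close>,
    so a lower bound of \<open>X\<close> is below \<open>e x\<close> at every index.\<close>
  define e where "e x = (if x \<in> X then x else a0)" for x
  have e: "range e \<subseteq> carrier A" using XA a0 by (auto simp: e_def)
  have eB: "rclass U e \<in> carrier ?B" and dB: "\<And>a. a \<in> carrier A \<Longrightarrow> ?d a \<in> carrier ?B"
    using e by (auto intro: rclass_in_carrier)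
  define p where "p = r (rclass U e)"
  have rA: "r c \<in> carrier A" if "c \<in> carrier ?B" for c
    using r(1) that by (auto simp: ualg_hom_def)
  then have pA: "p \<in> carrier A" using eB by (simp add: p_def)

  \<comment> \<open>On the \<open>U\<close>-large set \<open>D a\<close> the value
    \<open>e x\<close> is below \<open>a\<close>. This is the equation
    \<open>binop ?B tm (rclass U e) (?d a) = rclass U e\<close> in the ultrapower, and
    \<open>r\<close> carries it to \<open>A\<close>.\<close>
  have lower: "?m p a = p" if a: "a \<in> X" for a
  proof -
    have aA: "a \<in> carrier A" using a XA by auto
    have "\<forall>\<^sub>F x in U. ?m (e x) a = e x"
      using evD[OF a] by (rule eventually_mono) (auto simp: D_def e_def)
    then have "binop ?B tm (rclass U e) (?d a) = rclass U e"
      using aA e by (subst binop_reduced_power[OF A wf]) (auto simp: rclass_eq_iff)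
    then have "r (binop ?B tm (rclass U e) (?d a)) = p" by (simp add: p_def)
    then show ?thesis
      by (simp add: binop_hom[OF r(1) B(2) wf eB dB] aA r(2) p_def)
  qed
  have greatest: "?m b p = b" if b: "b \<in> carrier A" "\<And>a. a \<in> X \<Longrightarrow> ?m b a = b" for b
  proof -
    have "?m b (e x) = b" for x
      using b(2) a0 by (auto simp: e_def)
    then have "binop ?B tm (?d b) (rclass U e) = ?d b"
      using b(1) e by (subst binop_reduced_power[OF A wf]) auto
    then have "r (binop ?B tm (?d b) (rclass U e)) = b" by (simp add: r(2) b(1))
    then show ?thesis
      by (simp add: binop_hom[OF r(1) B(2) wf dB eB] b(1) r(2) p_def)
  qed
  have "is_glb (natural_order A tm) p X"
    using XA pA lower by (auto simp: greatest_def Lower_def natural_order_def intro!: greatest)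
  moreover have "sat_at A P p" if P: "wf_fm ar P" "positive P" "\<forall>a\<in>X. sat_at A P a" for P
  proof -
    have "\<forall>\<^sub>F x in U. sat A (\<lambda>_. e x) P"
      using evX by (rule eventually_mono) (use P(3) in \<open>auto simp: e_def sat_at_def\<close>)
    then have "sat ?B (\<lambda>_. rclass U e) P"
      using positive_sat_ultrapower[OF A U(2) P(1,2), of "\<lambda>_. e"] e by blast
    \<comment> \<open>A retraction is onto, since \<open>a\<close> is the image of its diagonal
      class; positive truth therefore passes from \<open>rclass U e\<close> to
      \<open>p\<close>.\<close>
    moreover have "r ` carrier ?B = carrier A"
    proof
      show "r ` carrier ?B \<subseteq> carrier A" using rA by auto
      show "carrier A \<subseteq> r ` carrier ?B"
        using r(2) dB by (metis image_eqI subsetI)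
    qed
    ultimately have "sat A (\<lambda>_. r (rclass U e)) P"
      using eB by (intro positive_sat_surj_hom[OF r(1) B(2) _ P(1,2)]) auto
    then show ?thesis by (simp add: sat_at_def p_def)
  qed
  ultimately show thesis by (rule that)
qed

theorem theorem3p3:
  fixes ar :: "'f \<Rightarrow> nat"
    and E :: "('f trm \<times> 'f trm) set"
    and tj tm :: "'f trm"
    and A :: "('a, 'f) ualg"
    and X :: "'a set"
  assumes "wf_identities ar E"
    and "lattice_terms TYPE(('a, 'f) universe) ar E tj tm"
    and "absolute_retract TYPE(('a, 'f) universe) ar E A"
    and "down_directed (natural_order A tm) X"
  shows "(\<exists>p. is_glb (natural_order A tm) p X) \<and>
    (\<forall>P x. wf_fm ar P \<longrightarrow> positive P \<longrightarrow> free_vars P \<subseteq> {x} \<longrightarrow>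
       (\<forall>a\<in>X. sat_at A P a) \<longrightarrow> sat_at A P (\<Sqinter>\<^bsub>natural_order A tm\<^esub> X))"
proof -
  obtain p where p: "is_glb (natural_order A tm) p X"
    "\<And>P. wf_fm ar P \<Longrightarrow> positive P \<Longrightarrow> \<forall>a\<in>X. sat_at A P a \<Longrightarrow> sat_at A P p"
    using glb_down_directed[OF assms] by metis
  have "in_variety ar E A" using assms(3) by (simp add: absolute_retract_def)
  note lat = lattice_ops_variety[OF assms(1,2) this]
  \<comment> \<open>The infimum is defined by Hilbert choice among the greatest lower bounds;
    uniqueness identifies it with the \<open>p\<close> constructed from the ultrapower.\<close>
  have "\<Sqinter>\<^bsub>natural_order A tm\<^esub> X = p"
    unfolding inf_def
    by (rule some_equality) (use p(1) glb_natural_order_unique[OF lat] in blast)+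
  then show ?thesis using p by auto
qed

end
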